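(* Let $p\geq 2$ and $k\geq 1$ be integers and let $k_0=\log_e^* p-1$. Then, with absolute constants implicit in $\Theta(\cdot)$: (1) if $k\leq k_0$, then $\mathrm{b}_k(p)^{1/p}=\Theta\!\left(p/\log_e^{(k)}p\right)$; (2) if $k>k_0$, then $\mathrm{b}_k(p)^{1/p}=\Theta\!\left(p\,(k-k_0)^{1-1/p}\right)=\Theta\!\left(p\cdot\min\{k^{1-1/p},\,k-k_0\}\right)$.
   Context: A $k$-level partition of $[p]$ is a tuple $(T_1,\dots,T_k)$ where $T_1$ is a partition of $[p]$ into nonempty parts and $T_i$ is a refinement of $T_{i-1}$ for $i=2,\dots,k$; $\mathrm{b}_k(p)$ is the number of $k$-level partitions of $[p]$ (the order-$k$ Bell number). $\log_e^{(k)}p$ denotes the $k$-fold iterate of the natural logarithm applied to $p$ ($\log_e^{(0)}p=p$), and $\log_e^*p$ is the smallest $k$ such that $\log_e^{(k)}p\leq 1$. *)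

theory Defs
  imports "HOL-Analysis.Analysis" "HOL-Library.Disjoint_Sets"
begin

definition refines_on :: "'a set \<Rightarrow> 'a set set \<Rightarrow> 'a set set \<Rightarrow> bool" where
  "refines_on A Q P \<longleftrightarrow> partition_on A Q \<and> (\<forall>B\<in>Q. \<exists>C\<in>P. B \<subseteq> C)"

(* k-level partitions of [p] = {1..p}, as lists [T_1,...,T_k] (list index i = T_(i+1)) *)
definition level_partitions :: "nat \<Rightarrow> nat \<Rightarrow> nat set set list set" where
  "level_partitions k p = {Ts. length Ts = k \<and> (k \<ge> 1 \<longrightarrow> partition_on {1..p} (Ts ! 0)) \<and>
      (\<forall>i. 1 \<le> i \<and> i < k \<longrightarrow> refines_on {1..p} (Ts ! i) (Ts ! (i - 1)))}"

definition bell_k :: "nat \<Rightarrow> nat \<Rightarrow> nat" where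
  "bell_k k p = card (level_partitions k p)"

definition iter_ln :: "nat \<Rightarrow> real \<Rightarrow> real" where
  "iter_ln k x = (ln ^^ k) x"

definition log_star :: "real \<Rightarrow> nat" where
  "log_star x = (LEAST k. iter_ln k x \<le> 1)"

end

theory Submission
  imports Defs "HOL-Combinatorics.Stirling"
begin

text \<open>
  Peeling off the finest partition gives \<open>b\<^sub>k\<^sub>+\<^sub>1(p) = \<Sum>\<^sub>j S(p, j) b\<^sub>k(j)\<close> with Stirling numbers of the
  second kind, so the exponential generating function of \<open>b\<^sub>k\<close> is the \<open>(k+1)\<close>-fold iterate of
  \<open>f(x) = e\<^sup>x - 1\<close>. Hence \<open>b\<^sub>k(p) \<le> p! f\<^sup>(\<^sup>k\<^sup>+\<^sup>1\<^sup>)(x) / x\<^sup>p\<close> for every \<open>x > 0\<close>. Take \<open>x\<close> to be the \<open>k\<close>-fold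
  logarithm of \<open>p\<close> if \<open>k \<le> k\<^sub>0\<close>; for \<open>m = k - k\<^sub>0 > 0\<close> take \<open>x\<close> of order \<open>1/m\<close>, where
  \<open>f(x) \<le> x/(1 - x)\<close> controls the first \<open>m\<close> iterates.

  For the lower bounds keep a single term \<open>S(p, j) b\<^sub>k(j)\<close> of the recurrence at each level. If
  \<open>p \<le> exp\<^sup>(\<^sup>k\<^sup>)(L)\<close>, taking \<open>j\<close> about \<open>p/L\<close> replaces \<open>L\<close> by \<open>e\<^sup>L\<close> and yields
  \<open>b\<^sub>k(p) \<ge> (c p/L)\<^sup>p\<close>. The \<open>m \<le> p\<close> further levels of the second regime each take
  \<open>j\<close> about \<open>p (1 - 1/m)\<close> with \<open>S(p, p - i) \<ge> (p\<^sup>2/8i)\<^sup>i\<close>; for \<open>m > p\<close> it suffices to count chains that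
  merge two blocks at a time.
\<close>

section \<open>The recurrence\<close>

text \<open>The recurrence of the Stirling numbers is obtained by adding one point \<open>a\<close>:
  either \<open>a\<close> forms a block of its own (\<open>X\<close>), or it joins one of the
  \<open>j\<close> blocks of a partition of \<open>A\<close> (\<open>Y\<close>).\<close>

lemma card_partitions_eq_Stirling:
  assumes "finite A"
  shows "card {P. partition_on A P \<and> card P = j} = Stirling (card A) j"
  using assms
proof (induction A arbitrary: j rule: finite_induct)
  case empty
  have "{P :: 'a set set. P = {} \<and> card P = 0} = {{}}" by auto
  then show ?case by (cases j) (auto simp: partition_on_empty)
next
  case (insert a A j)
  define S where "S = (\<lambda>j. {P. partition_on A P \<and> card P = j})"
  define g where "g = (\<lambda>(P, B). insert (insert a B) (P - {B}))"
  define X where "X = {P. partition_on (insert a A) P \<and> card P = j \<and> {a} \<in> P}"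
  define Y where "Y = {P. partition_on (insert a A) P \<and> card P = j \<and> {a} \<notin> P}"
  have finP: "finite P" if "partition_on A P" for P
    using that insert.hyps(1) finite_elements by blast
  have finQ: "finite P" if "partition_on (insert a A) P" for P
    using that insert.hyps(1) finite_elements by blast
  have finS: "finite (S j)" for j
    unfolding S_def using finitely_many_partition_on[OF insert.hyps(1)] by (auto intro: finite_subset)
  have cardX: "card X = (case j of 0 \<Rightarrow> 0 | Suc i \<Rightarrow> card (S i))"
  proof (cases j)
    case 0
    then have "X = {}" unfolding X_def using finQ by auto
    then show ?thesis using 0 by simp
  next
    case (Suc i)
    have "bij_betw (insert {a}) (S i) X"
    proof (rule bij_betw_byWitness[where f' = "\<lambda>P. P - {{a}}"])
      show "\<forall>P\<in>S i. insert {a} P - {{a}} = P"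
        using insert.hyps(2) by (auto simp: S_def partition_on_def)
      show "\<forall>P\<in>X. insert {a} (P - {{a}}) = P" by (auto simp: X_def)
      show "insert {a} ` S i \<subseteq> X"
      proof
        fix Q assume "Q \<in> insert {a} ` S i"
        then obtain P where P: "partition_on A P" "card P = i" "Q = insert {a} P"
          by (auto simp: S_def)
        have "{a} \<notin> P" using P insert.hyps(2) by (auto simp: partition_on_def)
        then have "card Q = j" using P finP Suc by simp
        moreover have "partition_on (insert a A) Q"
          using P insert.hyps(2) by (auto simp: partition_on_def pairwise_insert disjnt_def)
        ultimately show "Q \<in> X" using P by (auto simp: X_def)
      qed
      show "(\<lambda>P. P - {{a}}) ` X \<subseteq> S i"
      proof
        fix Q assume "Q \<in> (\<lambda>P. P - {{a}}) ` X"
        then obtain P where P: "partition_on (insert a A) P" "card P = j" "{a} \<in> P" "Q = P - {{a}}"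
          by (auto simp: X_def)
        have disj: "B \<inter> C = {}" if "B \<in> P" "C \<in> P" "B \<noteq> C" for B C
          using P that by (auto simp: partition_on_def pairwise_def disjnt_def)
        have un: "\<Union>P = insert a A" using P by (auto simp: partition_on_def)
        have "\<Union>Q = A"
        proof
          have "a \<notin> B" if "B \<in> Q" for B using disj[of "{a}" B] that P(3,4) by auto
          moreover have "\<Union>Q \<subseteq> insert a A" using un P(4) by blast
          ultimately show "\<Union>Q \<subseteq> A" by blast
          show "A \<subseteq> \<Union>Q"
          proof
            fix x assume "x \<in> A"
            then have "x \<noteq> a" "x \<in> \<Union>P" using un insert.hyps(2) by auto
            then show "x \<in> \<Union>Q" using P(4) by blast
          qed
        qed
        then have "partition_on A Q"
          using P by (auto simp: partition_on_def pairwise_def)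
        then show "Q \<in> S i" using P Suc finQ[OF P(1)] by (auto simp: S_def)
      qed
    qed
    then show ?thesis using Suc by (simp add: bij_betw_same_card)
  qed
  have cardY: "card Y = j * card (S j)"
  proof -
    have "bij_betw g (SIGMA P:S j. P) Y"
    proof (rule bij_betw_imageI)
      have nota: "a \<notin> B" if "P \<in> S j" "B \<in> P" for P B
        using that insert.hyps(2) by (auto simp: S_def partition_on_def)
      \<comment> \<open>The pair can be read off from its image: the only block containing
        \<open>a\<close> is \<open>insert a B\<close>, and the other blocks are exactly
        \<open>P - {B}\<close>.\<close>
      have with_a: "{C \<in> g (P, B). a \<in> C} = {insert a B}" and without_a: "{C \<in> g (P, B). a \<notin> C} = P - {B}"
        if "P \<in> S j" for P B
        using nota[OF that] unfolding g_def prod.case by blast+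
      show "inj_on g (SIGMA P:S j. P)"
      proof (rule inj_onI, clarify)
        fix P B P' B'
        assume h: "P \<in> S j" "B \<in> P" "P' \<in> S j" "B' \<in> P'" "g (P, B) = g (P', B')"
        have "insert a B = insert a B'" "P - {B} = P' - {B'}"
          using with_a[of P B] with_a[of P' B'] without_a[of P B] without_a[of P' B'] h by simp_all
        moreover from this(1) have "B = B'" using nota h by (metis insert_ident)
        ultimately show "P = P' \<and> B = B'" using h by blast
      qed
      show "g ` (SIGMA P:S j. P) = Y"
      proof (intro equalityI subsetI)
        fix Q assume "Q \<in> g ` (SIGMA P:S j. P)"
        then obtain P B where P: "P \<in> S j" "B \<in> P" "Q = insert (insert a B) (P - {B})"
          by (auto simp: g_def)
        have disj: "B \<inter> C = {}" if "B \<in> P" "C \<in> P" "B \<noteq> C" for B C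
          using P(1) that by (auto simp: S_def partition_on_def pairwise_def disjnt_def)
        have "B \<noteq> {}" "\<Union>P = A" "{} \<notin> P" using P(1,2) by (auto simp: S_def partition_on_def)
        have un: "\<Union>Q = insert a A" using P(2,3) \<open>\<Union>P = A\<close> by auto
        have "disjoint Q"
          unfolding P(3) pairwise_insert
        proof (intro conjI allI impI)
          show "disjoint (P - {B})" using P(1) by (auto simp: S_def partition_on_def pairwise_def)
          fix C assume "C \<in> P - {B} \<and> C \<noteq> insert a B"
          then have "insert a B \<inter> C = {}" using disj[of B C] nota[OF P(1), of C] P(2) by auto
          then show "disjnt (insert a B) C" "disjnt C (insert a B)" by (auto simp: disjnt_def)
        qed
        then have "partition_on (insert a A) Q" using un P(3) \<open>{} \<notin> P\<close>
          by (auto simp: partition_on_def)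
        moreover have "card Q = j"
        proof -
          have "finite P" "card P = j" using P(1) finP by (auto simp: S_def)
          moreover have "insert a B \<notin> P - {B}" using nota[OF P(1)] by blast
          ultimately show ?thesis using P(2,3) card_Suc_Diff1[of P B] by simp
        qed
        moreover have "{a} \<notin> Q" using P nota[OF P(1)] \<open>B \<noteq> {}\<close> by auto
        ultimately show "Q \<in> Y" by (auto simp: Y_def)
      next
        fix Q assume "Q \<in> Y"
        then have Q: "partition_on (insert a A) Q" "card Q = j" "{a} \<notin> Q" by (auto simp: Y_def)
        have disj: "B \<inter> C = {}" if "B \<in> Q" "C \<in> Q" "B \<noteq> C" for B C
          using Q(1) that by (auto simp: partition_on_def pairwise_def disjnt_def)
        have un: "\<Union>Q = insert a A" "{} \<notin> Q" using Q(1) by (auto simp: partition_on_def)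
        then obtain B where B: "B \<in> Q" "a \<in> B" by blast
        define P where "P = insert (B - {a}) (Q - {B})"
        have ne: "B - {a} \<noteq> {}" using B Q(3) by (metis insert_Diff_single insert_absorb insert_is_Un sup_bot.right_neutral)
        \<comment> \<open>\<open>B - {a}\<close> is not already a block, so replacing
          \<open>B\<close> by it keeps the number of blocks and can be undone by
          \<open>g\<close>.\<close>
        have notin: "B - {a} \<notin> Q - {B}" using disj[of B "B - {a}"] B ne by blast
        have "\<Union>P = \<Union>Q - {a}"
        proof -
          have "a \<notin> C" if "C \<in> Q - {B}" for C using that disj[of B C] B by blast
          moreover have "\<Union>Q = B \<union> \<Union>(Q - {B})" using B by blast
          ultimately show ?thesis unfolding P_def by blast
        qed
        then have "\<Union>P = A" using un insert.hyps(2) by auto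
        moreover have "disjoint P" unfolding P_def pairwise_insert
        proof (intro conjI allI impI)
          show "disjoint (Q - {B})" using Q(1) by (auto simp: partition_on_def pairwise_def)
          fix C assume "C \<in> Q - {B} \<and> C \<noteq> B - {a}"
          then have "(B - {a}) \<inter> C = {}" using disj[of B C] B by auto
          then show "disjnt (B - {a}) C" "disjnt C (B - {a})" by (auto simp: disjnt_def)
        qed
        ultimately have "partition_on A P" using ne un(2) by (auto simp: partition_on_def P_def)
        moreover have "card P = j"
          using notin finQ[OF Q(1)] Q(2) card_Suc_Diff1[of Q B] B(1) by (simp add: P_def)
        ultimately have "P \<in> S j" by (auto simp: S_def)
        moreover have "Q = g (P, B - {a})"
          using B notin by (auto simp: g_def P_def insert_absorb)
        moreover have "B - {a} \<in> P" by (simp add: P_def)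
        ultimately show "Q \<in> g ` (SIGMA P:S j. P)" by (metis SigmaI image_eqI)
      qed
    qed
    then have "card Y = card (SIGMA P:S j. P)" by (simp add: bij_betw_same_card)
    also have "\<dots> = (\<Sum>P\<in>S j. card P)"
      using finS finP by (subst card_SigmaI) (auto simp: S_def)
    also have "\<dots> = j * card (S j)" by (simp add: S_def)
    finally show ?thesis .
  qed
  have "{P. partition_on (insert a A) P \<and> card P = j} = X \<union> Y" "X \<inter> Y = {}"
    by (auto simp: X_def Y_def)
  moreover have "finite {P. partition_on (insert a A) P \<and> card P = j}"
    using finitely_many_partition_on[of "insert a A"] insert.hyps(1) by (auto intro: finite_subset)
  ultimately have "card {P. partition_on (insert a A) P \<and> card P = j} = card X + card Y"
    by (simp add: card_Un_disjoint)
  also have "\<dots> = Stirling (card (insert a A)) j"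
    using insert.IH insert.hyps cardX cardY by (cases j) (auto simp: S_def)
  finally show ?case .
qed

section \<open>Level partitions as lists\<close>

text \<open>Refinement is transitive, so the condition on neighbours extends to all pairs. The case
  \<open>i = j\<close> is included because it yields that every entry is a partition.\<close>

lemma refines_on_level_partitions:
  assumes "Ts \<in> level_partitions k p" "i \<le> j" "j < k"
  shows "refines_on {1..p} (Ts ! j) (Ts ! i)"
  using assms(2,3)
proof (induction j rule: dec_induct)
  case base
  then show ?case using assms(1)
    by (cases i) (auto simp: level_partitions_def refines_on_def)
next
  case (step n)
  have "refines_on {1..p} (Ts ! Suc n) (Ts ! n)"
    using assms(1) step.prems by (auto simp: level_partitions_def)
  then show ?case using step unfolding refines_on_def by (meson Suc_lessD subset_trans)
qed

text \<open>The last entry is the finest one. Demanding that \<open>Q\<close> refine every earlier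
  entry, not just its neighbour, also covers \<open>k = 0\<close> and turns the lists over a fixed
  \<open>Q\<close> into lists of partitions built from blocks of \<open>Q\<close>.\<close>

lemma level_partitions_append:
  "Ts @ [Q] \<in> level_partitions (Suc k) p \<longleftrightarrow>
     Ts \<in> level_partitions k p \<and> partition_on {1..p} Q \<and> (\<forall>T\<in>set Ts. refines_on {1..p} Q T)"
proof (intro iffI conjI ballI)
  assume l: "Ts @ [Q] \<in> level_partitions (Suc k) p"
  have len: "length Ts = k" using l by (simp add: level_partitions_def)
  have nth: "(Ts @ [Q]) ! i = Ts ! i" if "i < k" for i using that len by (simp add: nth_append)
  have last: "(Ts @ [Q]) ! k = Q" using len by (simp add: nth_append)
  show "Ts \<in> level_partitions k p"
    unfolding level_partitions_def mem_Collect_eq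
  proof (intro conjI impI allI)
    show "partition_on {1..p} (Ts ! 0)" if "k \<ge> 1"
      using refines_on_level_partitions[OF l, of 0 0] nth[of 0] that by (simp add: refines_on_def)
    show "refines_on {1..p} (Ts ! i) (Ts ! (i - 1))" if "1 \<le> i \<and> i < k" for i
      using refines_on_level_partitions[OF l, of "i - 1" i] nth[of i] nth[of "i - 1"] that
      by (metis diff_le_self less_SucI less_imp_diff_less)
  qed (rule len)
  show "partition_on {1..p} Q"
    using refines_on_level_partitions[OF l, of k k] last by (simp add: refines_on_def)
  fix T assume "T \<in> set Ts"
  then obtain i where "i < k" "T = Ts ! i" using len by (auto simp: in_set_conv_nth)
  then show "refines_on {1..p} Q T"
    using refines_on_level_partitions[OF l, of i k] last nth by simp
next
  assume r: "Ts \<in> level_partitions k p \<and> partition_on {1..p} Q \<and> (\<forall>T\<in>set Ts. refines_on {1..p} Q T)"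
  then show "Ts @ [Q] \<in> level_partitions (Suc k) p"
    by (auto simp: level_partitions_def nth_append less_Suc_eq)
qed

lemma partition_on_level_partitions:
  assumes "Ts \<in> level_partitions k p" "T \<in> set Ts"
  shows "partition_on {1..p} T"
proof -
  obtain i where "i < k" "T = Ts ! i"
    using assms by (auto simp: in_set_conv_nth level_partitions_def)
  then show ?thesis
    using refines_on_level_partitions[OF assms(1), of i i] by (simp add: refines_on_def)
qed

lemma finite_level_partitions: "finite (level_partitions k p)"
proof (rule finite_subset)
  show "level_partitions k p \<subseteq> {Ts. set Ts \<subseteq> {P. partition_on {1..p} P} \<and> length Ts = k}"
    using partition_on_level_partitions by (auto simp: level_partitions_def)
  show "finite {Ts. set Ts \<subseteq> {P. partition_on {1..p} P} \<and> length Ts = k}"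
    using finitely_many_partition_on[of "{1..p}"] by (intro finite_lists_length_eq) simp
qed

text \<open>Fixing the finest partition \<open>Q\<close>, with blocks indexed by \<open>h\<close>, the coarser partitions correspond
  to the partitions of the index set; the correspondence preserves refinement in both directions.\<close>

context
  fixes A :: "'a set" and Q :: "'a set set" and I :: "'i set" and h :: "'i \<Rightarrow> 'a set"
  assumes Q: "partition_on A Q" and h: "bij_betw h I Q"
begin

lemma block_index_unique:
  assumes "i \<in> I" "j \<in> I" "x \<in> h i" "x \<in> h j"
  shows "i = j"
proof -
  have "h i \<in> Q" "h j \<in> Q" using h assms by (auto simp: bij_betw_def)
  moreover have "disjoint Q" using Q by (simp add: partition_on_def)
  ultimately have "h i = h j" using assms(3,4) disjointD[of Q "h i" "h j"] by auto
  then show ?thesis using h assms(1,2) by (auto simp: bij_betw_def dest: inj_onD)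
qed

lemma block_nonempty: "i \<in> I \<Longrightarrow> h i \<noteq> {}"
  using Q h by (auto simp: partition_on_def bij_betw_def)

text \<open>Blocks are nonempty and disjoint, so any point of \<open>h i\<close> identifies
  \<open>i\<close>; a union of blocks therefore determines its index set.\<close>

lemma Union_blocks_subset_iff:
  assumes "C \<subseteq> I" "D \<subseteq> I"
  shows "\<Union>(h ` C) \<subseteq> \<Union>(h ` D) \<longleftrightarrow> C \<subseteq> D"
proof
  assume sub: "\<Union>(h ` C) \<subseteq> \<Union>(h ` D)"
  show "C \<subseteq> D"
  proof
    fix i assume i: "i \<in> C"
    then obtain x where x: "x \<in> h i" using block_nonempty assms by blast
    then obtain j where "j \<in> D" "x \<in> h j" using sub i by blast
    then show "i \<in> D" using block_index_unique[of i j x] x i assms by auto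
  qed
qed auto

lemma inj_on_Union_blocks: "inj_on (\<lambda>C. \<Union>(h ` C)) (Pow I)"
proof (rule inj_onI)
  fix C D assume "C \<in> Pow I" "D \<in> Pow I" "\<Union>(h ` C) = \<Union>(h ` D)"
  then show "C = D" using Union_blocks_subset_iff[of C D] Union_blocks_subset_iff[of D C] by simp
qed

lemma partition_on_Union_blocks:
  assumes "P \<subseteq> Pow I"
  shows "partition_on A ((\<lambda>C. \<Union>(h ` C)) ` P) \<longleftrightarrow> partition_on I P"
proof -
  have "\<Union>((\<lambda>C. \<Union>(h ` C)) ` P) = A \<longleftrightarrow> \<Union>(h ` \<Union>P) = \<Union>(h ` I)"
    using Q h by (auto simp: partition_on_def bij_betw_def)
  also have "\<dots> \<longleftrightarrow> \<Union>P = I"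
  proof -
    have "\<Union>P \<subseteq> I" using assms by auto
    then show ?thesis using Union_blocks_subset_iff[of I "\<Union>P"] by blast
  qed
  finally have un: "\<Union>((\<lambda>C. \<Union>(h ` C)) ` P) = A \<longleftrightarrow> \<Union>P = I" .
  have dis: "disjnt (\<Union>(h ` C)) (\<Union>(h ` D)) \<longleftrightarrow> disjnt C D" if "C \<in> P" "D \<in> P" for C D
  proof
    assume d: "disjnt C D"
    show "disjnt (\<Union>(h ` C)) (\<Union>(h ` D))" unfolding disjnt_iff
    proof (intro allI notI)
      fix x assume "x \<in> \<Union>(h ` C) \<and> x \<in> \<Union>(h ` D)"
      then obtain i j where "i \<in> C" "j \<in> D" "x \<in> h i" "x \<in> h j" by blast
      then show False using block_index_unique[of i j x] that assms d by (auto simp: disjnt_iff)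
    qed
  next
    assume "disjnt (\<Union>(h ` C)) (\<Union>(h ` D))"
    then show "disjnt C D" using block_nonempty that assms unfolding disjnt_iff by blast
  qed
  have eqiff: "\<Union>(h ` C) = \<Union>(h ` D) \<longleftrightarrow> C = D" if "C \<in> P" "D \<in> P" for C D
    using inj_on_Union_blocks that assms by (auto simp: inj_on_def)
  have "disjoint ((\<lambda>C. \<Union>(h ` C)) ` P) \<longleftrightarrow> disjoint P"
  proof -
    have "disjoint ((\<lambda>C. \<Union>(h ` C)) ` P) \<longleftrightarrow>
        (\<forall>C\<in>P. \<forall>D\<in>P. \<Union>(h ` C) \<noteq> \<Union>(h ` D) \<longrightarrow> disjnt (\<Union>(h ` C)) (\<Union>(h ` D)))"
      unfolding pairwise_def ball_simps(9) ..
    also have "\<dots> \<longleftrightarrow> disjoint P" unfolding pairwise_def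
      by (intro ball_cong refl) (simp only: dis eqiff)
    finally show ?thesis .
  qed
  moreover have "{} \<in> (\<lambda>C. \<Union>(h ` C)) ` P \<longleftrightarrow> {} \<in> P"
  proof
    assume "{} \<in> (\<lambda>C. \<Union>(h ` C)) ` P"
    then obtain C where "C \<in> P" "\<Union>(h ` C) = {}" by force
    moreover have "C = {}"
    proof (rule ccontr)
      assume "C \<noteq> {}"
      then obtain i where "i \<in> C" by blast
      then show False using block_nonempty[of i] \<open>C \<in> P\<close> \<open>\<Union>(h ` C) = {}\<close> assms by auto
    qed
    ultimately show "{} \<in> P" by simp
  qed force
  ultimately show ?thesis using un by (simp add: partition_on_def)
qed

lemma coarser_eq_Union_blocks:
  assumes P: "partition_on A P" and "refines_on A Q P"
  obtains P' where "partition_on I P'" "P = (\<lambda>C. \<Union>(h ` C)) ` P'"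
proof -
  define P' where "P' = (\<lambda>X. {i \<in> I. h i \<subseteq> X}) ` P"
  have "\<Union>(h ` {i \<in> I. h i \<subseteq> X}) = X" if "X \<in> P" for X
  proof
    show "X \<subseteq> \<Union>(h ` {i \<in> I. h i \<subseteq> X})"
    proof
      fix x assume x: "x \<in> X"
      then have "x \<in> A" using that P by (auto simp: partition_on_def)
      then obtain i where i: "i \<in> I" "x \<in> h i" using Q h by (auto simp: partition_on_def bij_betw_def)
      then obtain Y where Y: "Y \<in> P" "h i \<subseteq> Y"
        using assms(2) h unfolding refines_on_def bij_betw_def by blast
      \<comment> \<open>The block \<open>h i\<close> lies in some block \<open>Y\<close> of
        \<open>P\<close>; it shares the point \<open>x\<close> with \<open>X\<close>, so
        disjointness forces \<open>Y = X\<close>. Thus \<open>X\<close> is the union of the blocks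
        it contains.\<close>
      then have "Y = X" using x i that P unfolding partition_on_def pairwise_def disjnt_def by blast
      then show "x \<in> \<Union>(h ` {i \<in> I. h i \<subseteq> X})" using i Y by blast
    qed
  qed auto
  then have "P = (\<lambda>C. \<Union>(h ` C)) ` P'" by (force simp: P'_def image_image)
  moreover have "P' \<subseteq> Pow I" by (auto simp: P'_def)
  ultimately show ?thesis using that partition_on_Union_blocks P by blast
qed

lemma refines_on_Union_blocks:
  assumes "P \<subseteq> Pow I" "R \<subseteq> Pow I"
  shows "refines_on A ((\<lambda>C. \<Union>(h ` C)) ` P) ((\<lambda>C. \<Union>(h ` C)) ` R) \<longleftrightarrow> refines_on I P R"
proof -
  have "\<Union>(h ` C) \<subseteq> \<Union>(h ` D) \<longleftrightarrow> C \<subseteq> D" if "C \<in> P" "D \<in> R" for C D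
    using that assms by (intro Union_blocks_subset_iff) auto
  then show ?thesis unfolding refines_on_def using partition_on_Union_blocks[OF assms(1)] by simp
qed

lemma refines_on_Union_blocks_finest:
  assumes "partition_on I P"
  shows "refines_on A Q ((\<lambda>C. \<Union>(h ` C)) ` P)"
  unfolding refines_on_def
proof (intro conjI ballI Q)
  fix B assume "B \<in> Q"
  then obtain i where "i \<in> I" "B = h i" using h by (auto simp: bij_betw_def)
  then show "\<exists>C\<in>(\<lambda>C. \<Union>(h ` C)) ` P. B \<subseteq> C" using assms by (auto simp: partition_on_def)
qed

end

text \<open>Once the blocks of \<open>Q\<close> are numbered, a chain of partitions coarser than
  \<open>Q\<close> is the same as a chain of partitions of the set of block numbers.\<close>

lemma card_level_partitions_coarser:
  assumes Q: "partition_on {1..p} Q"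
  shows "card {Ts \<in> level_partitions k p. \<forall>T\<in>set Ts. refines_on {1..p} Q T} = bell_k k (card Q)"
proof -
  have "finite Q" using Q finite_elements by blast
  then obtain h where h: "bij_betw h {1..card Q} Q"
    using ex_bij_betw_nat_finite_1 by blast
  define \<Phi> where "\<Phi> = (\<lambda>C. \<Union>(h ` C))"
  let ?I = "{1..card Q}"
  have inPow: "P \<subseteq> Pow ?I" if "partition_on ?I P" for P using that by (auto simp: partition_on_def)
  have lp_map: "map ((`) \<Phi>) Ts \<in> level_partitions k p \<longleftrightarrow> Ts \<in> level_partitions k (card Q)"
    if sub: "\<forall>T\<in>set Ts. T \<subseteq> Pow ?I" for Ts
  proof (cases "length Ts = k")
    case True
    have nth: "Ts ! i \<subseteq> Pow ?I" if "i < k" for i using that sub True by simp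
    then have "refines_on {1..p} (\<Phi> ` (Ts ! i)) (\<Phi> ` (Ts ! (i - 1))) \<longleftrightarrow> refines_on ?I (Ts ! i) (Ts ! (i - 1))"
      if "i < k" for i
      unfolding \<Phi>_def using that by (intro refines_on_Union_blocks[OF Q h]) auto
    moreover have "partition_on {1..p} (\<Phi> ` (Ts ! 0)) \<longleftrightarrow> partition_on ?I (Ts ! 0)" if "k \<ge> 1"
      unfolding \<Phi>_def using that nth[of 0] by (intro partition_on_Union_blocks[OF Q h]) auto
    ultimately show ?thesis using True by (auto simp: level_partitions_def)
  qed (simp add: level_partitions_def)
  have "bij_betw (map ((`) \<Phi>)) (level_partitions k (card Q))
      {Ts \<in> level_partitions k p. \<forall>T\<in>set Ts. refines_on {1..p} Q T}"
  proof (rule bij_betw_imageI)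
    have "inj_on ((`) \<Phi>) (Pow (Pow ?I))"
      unfolding \<Phi>_def using inj_on_Union_blocks[OF Q h] by (rule inj_on_image_Pow)
    then have "inj_on (map ((`) \<Phi>)) (lists (Pow (Pow ?I)))" by (rule inj_on_mapI[OF inj_on_subset]) auto
    moreover have "level_partitions k (card Q) \<subseteq> lists (Pow (Pow ?I))"
      using partition_on_level_partitions inPow by blast
    ultimately show "inj_on (map ((`) \<Phi>)) (level_partitions k (card Q))" by (rule inj_on_subset)
    show "map ((`) \<Phi>) ` level_partitions k (card Q) = {Ts \<in> level_partitions k p. \<forall>T\<in>set Ts. refines_on {1..p} Q T}"
    proof (intro equalityI subsetI)
      fix Us assume "Us \<in> map ((`) \<Phi>) ` level_partitions k (card Q)"
      then obtain Ts where Ts: "Ts \<in> level_partitions k (card Q)" "Us = map ((`) \<Phi>) Ts" by blast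
      then show "Us \<in> {Ts \<in> level_partitions k p. \<forall>T\<in>set Ts. refines_on {1..p} Q T}"
        using lp_map[of Ts] partition_on_level_partitions[OF Ts(1)] inPow
          refines_on_Union_blocks_finest[OF Q h] by (auto simp: \<Phi>_def)
    next
      fix Us assume "Us \<in> {Ts \<in> level_partitions k p. \<forall>T\<in>set Ts. refines_on {1..p} Q T}"
      then have Us: "Us \<in> level_partitions k p" "\<forall>T\<in>set Us. refines_on {1..p} Q T" by auto
      have "\<forall>U\<in>set Us. \<exists>T. partition_on ?I T \<and> U = \<Phi> ` T"
        using coarser_eq_Union_blocks[OF Q h] partition_on_level_partitions[OF Us(1)] Us(2)
        unfolding \<Phi>_def by metis
      then obtain t where t: "\<And>U. U \<in> set Us \<Longrightarrow> partition_on ?I (t U)" "\<And>U. U \<in> set Us \<Longrightarrow> U = \<Phi> ` t U"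
        by metis
      have "Us = map ((`) \<Phi>) (map t Us)" using t(2) by (auto simp: map_idI)
      moreover from this have "map t Us \<in> level_partitions k (card Q)"
        using lp_map[of "map t Us"] Us(1) t(1) inPow by auto
      ultimately show "Us \<in> map ((`) \<Phi>) ` level_partitions k (card Q)" by blast
    qed
  qed
  then show ?thesis unfolding bell_k_def by (simp add: bij_betw_same_card)
qed

lemma bell_k_0: "bell_k 0 p = 1"
proof -
  have "level_partitions 0 p = {[]}" by (auto simp: level_partitions_def)
  then show ?thesis by (simp add: bell_k_def)
qed

text \<open>Split off the finest partition \<open>Q\<close>. The number of ways to complete it
  depends only on \<open>card Q\<close>, so the sum over \<open>Q\<close> is grouped by the number
  of blocks.\<close>

lemma bell_k_Suc: "bell_k (Suc k) p = (\<Sum>j\<le>p. Stirling p j * bell_k k j)"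
proof -
  let ?P = "{Q. partition_on {1..p} Q}"
  let ?C = "\<lambda>Q. {Ts \<in> level_partitions k p. \<forall>T\<in>set Ts. refines_on {1..p} Q T}"
  have finP: "finite ?P" by (rule finitely_many_partition_on) simp
  have "bij_betw (\<lambda>(Q, Ts). Ts @ [Q]) (SIGMA Q:?P. ?C Q) (level_partitions (Suc k) p)"
  proof (rule bij_betw_imageI)
    show "inj_on (\<lambda>(Q, Ts). Ts @ [Q]) (SIGMA Q:?P. ?C Q)" by (auto simp: inj_on_def)
    show "(\<lambda>(Q, Ts). Ts @ [Q]) ` (SIGMA Q:?P. ?C Q) = level_partitions (Suc k) p"
    proof (intro equalityI subsetI)
      fix Us assume "Us \<in> level_partitions (Suc k) p"
      moreover from this obtain Ts Q where "Us = Ts @ [Q]"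
        by (cases Us rule: rev_cases) (auto simp: level_partitions_def)
      ultimately show "Us \<in> (\<lambda>(Q, Ts). Ts @ [Q]) ` (SIGMA Q:?P. ?C Q)"
        using level_partitions_append by force
    qed (use level_partitions_append in auto)
  qed
  then have "bell_k (Suc k) p = card (SIGMA Q:?P. ?C Q)"
    by (simp add: bell_k_def bij_betw_same_card)
  also have "\<dots> = (\<Sum>Q\<in>?P. card (?C Q))"
    using finP finite_level_partitions by (intro card_SigmaI) auto
  also have "\<dots> = (\<Sum>Q\<in>?P. bell_k k (card Q))"
    by (intro sum.cong refl card_level_partitions_coarser) simp
  also have "\<dots> = (\<Sum>j\<le>p. \<Sum>Q\<in>{Q\<in>?P. card Q = j}. bell_k k (card Q))"
  proof (rule sum.group[symmetric, OF finP])
    show "card ` ?P \<subseteq> {..p}"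
    proof safe
      fix Q :: "nat set set" assume Q: "partition_on {1..p} Q"
      then have fin: "finite Q" using finite_elements by blast
      have "card Q = (\<Sum>B\<in>Q. 1)" by simp
      also have "\<dots> \<le> (\<Sum>B\<in>Q. card B)"
      proof (rule sum_mono)
        fix B assume "B \<in> Q"
        then have "B \<noteq> {}" "B \<subseteq> {1..p}" using Q by (auto simp: partition_on_def)
        then show "1 \<le> card B" using finite_subset[of B "{1..p}"] card_gt_0_iff[of B] by auto
      qed
      also have "\<dots> = card (\<Union>Q)"
      proof (rule card_Union_disjoint[symmetric])
        show "disjoint Q" using Q by (simp add: partition_on_def)
        show "finite B" if "B \<in> Q" for B
          using Q that by (intro finite_subset[of B "{1..p}"]) (auto simp: partition_on_def)
      qed
      also have "\<dots> = p" using Q by (simp add: partition_on_def)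
      finally show "card Q \<le> p" .
    qed
  qed simp
  also have "\<dots> = (\<Sum>j\<le>p. Stirling p j * bell_k k j)"
    using card_partitions_eq_Stirling[of "{1..p}"] by (intro sum.cong refl) simp
  finally show ?thesis .
qed

section \<open>Upper bounds\<close>

text \<open>The right side \<open>H\<close> satisfies \<open>H j' = j * H j + H (j - 1)\<close> for
  \<open>j > 0\<close>, while differentiating the partial sum \<open>G\<close> up to
  \<open>N + 1\<close> gives the same expression in partial sums up to \<open>N\<close>. By
  induction on \<open>N\<close> the difference has nonnegative derivative, and it vanishes at 0.
  Only finite sums occur, so convergence is never an issue.\<close>

lemma sum_Stirling_le:
  fixes x :: real
  assumes "x \<ge> 0"
  shows "(\<Sum>n\<le>N. real (Stirling n j) * x ^ n / fact n) \<le> (exp x - 1) ^ j / fact j"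
  using assms
proof (induction N arbitrary: j x)
  case 0
  then show ?case by (cases j) auto
next
  case (Suc N)
  define G where "G = (\<lambda>N j (x::real). \<Sum>n\<le>N. real (Stirling n j) * x ^ n / fact n)"
  define H where "H = (\<lambda>j (x::real). (exp x - 1) ^ j / fact j)"
  have G_Suc: "G (Suc N) j = (\<lambda>x. real (Stirling 0 j) + (\<Sum>n\<le>N. real (Stirling (Suc n) j) * x ^ Suc n / fact (Suc n)))" for j
    unfolding G_def by (simp add: sum.atMost_Suc_shift del: sum.atMost_Suc fact_Suc power_Suc)
  have le: "G N j y \<le> H j y" if "y \<ge> 0" for j y using Suc.IH that by (simp add: G_def H_def)
  show ?case
  proof (cases j)
    case 0
    have "G (Suc N) 0 x = 1" unfolding G_Suc by simp
    then show ?thesis using 0 by (simp add: G_def)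
  next
    case (Suc i)
    define D where "D = (\<lambda>y. (real j * H j y + H i y) - (real j * G N j y + G N i y))"
    have dG: "(G (Suc N) j has_real_derivative real j * G N j y + G N i y) (at y)" for y
    proof -
      have "((\<lambda>x. real (Stirling (Suc n) j) * x ^ Suc n / fact (Suc n)) has_real_derivative
          real (Stirling (Suc n) j) * y ^ n / fact n) (at y)" for n
      proof -
        have "((\<lambda>x. real (Stirling (Suc n) j) * x ^ Suc n / fact (Suc n)) has_real_derivative
          real (Stirling (Suc n) j) * (real (Suc n) * y ^ n) / fact (Suc n)) (at y)"
          by (auto intro!: derivative_eq_intros simp del: power_Suc fact_Suc)
        also have "real (Stirling (Suc n) j) * (real (Suc n) * y ^ n) / fact (Suc n) = real (Stirling (Suc n) j) * y ^ n / fact n"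
          using of_nat_0_less_iff[of "Suc n"] by (simp add: fact_Suc del: of_nat_Suc)
        finally show ?thesis .
      qed
      then have "(G (Suc N) j has_real_derivative 0 + (\<Sum>n\<le>N. real (Stirling (Suc n) j) * y ^ n / fact n)) (at y)"
        unfolding G_Suc by (intro DERIV_add DERIV_const DERIV_sum)
      moreover have "(\<Sum>n\<le>N. real (Stirling (Suc n) j) * y ^ n / fact n) = real j * G N j y + G N i y"
        unfolding G_def Suc by (simp add: sum_distrib_left sum.distrib[symmetric] field_simps)
      ultimately show ?thesis by simp
    qed
    have dH: "(H j has_real_derivative real j * H j y + H i y) (at y)" for y
    proof -
      have "(H j has_real_derivative (real (Suc i) * ((exp y - 1) ^ i * exp y)) / fact (Suc i)) (at y)"
        unfolding H_def Suc by (auto intro!: derivative_eq_intros simp del: power_Suc fact_Suc)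
      \<comment> \<open>Write \<open>exp y\<close> as \<open>(exp y - 1) + 1\<close>.\<close>
      also have "(real (Suc i) * ((exp y - 1) ^ i * exp y)) / fact (Suc i) = real j * H j y + H i y"
      proof -
        have "H i y = real (Suc i) * (exp y - 1) ^ i / fact (Suc i)"
          unfolding H_def by (simp add: fact_Suc del: of_nat_Suc)
        moreover have "H j y = (exp y - 1) * (exp y - 1) ^ i / fact (Suc i)"
          by (simp add: H_def Suc del: fact_Suc)
        ultimately show ?thesis
          by (simp only:) (simp add: Suc algebra_simps add_divide_distrib diff_divide_distrib del: fact_Suc of_nat_Suc)
      qed
      finally show ?thesis .
    qed
    have "H j 0 - G (Suc N) j 0 \<le> H j x - G (Suc N) j x"
    proof (rule DERIV_nonneg_imp_nondecreasing[OF Suc.prems])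
      fix y assume "0 \<le> y" "y \<le> x"
      have "((\<lambda>y. H j y - G (Suc N) j y) has_real_derivative D y) (at y)"
        unfolding D_def by (intro derivative_intros dG dH)
      moreover have "D y \<ge> 0"
        using le[OF \<open>0 \<le> y\<close>, of j] le[OF \<open>0 \<le> y\<close>, of i] by (simp add: D_def add_mono mult_left_mono)
      ultimately show "\<exists>d. ((\<lambda>y. H j y - G (Suc N) j y) has_real_derivative d) (at y) \<and> d \<ge> 0" by blast
    qed
    moreover have "H j 0 = 0" "G (Suc N) j 0 = 0" unfolding G_Suc by (auto simp: H_def Suc)
    ultimately have "G (Suc N) j x \<le> H j x" by linarith
    then show ?thesis by (simp only: G_def H_def)
  qed
qed

text \<open>The exponential generating function of the order-\<open>k\<close> Bell numbers without its constant term is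
  the \<open>(k+1)\<close>-fold iterate of \<open>e\<^sup>x - 1\<close>; bounding its partial sums suffices.\<close>

lemma sum_bell_k_le:
  fixes x :: real
  assumes "x \<ge> 0"
  shows "(\<Sum>p=1..N. real (bell_k k p) * x ^ p / fact p) \<le> ((\<lambda>x. exp x - 1) ^^ Suc k) x"
  using assms
proof (induction k arbitrary: x)
  case 0
  have "(\<Sum>p=1..N. x ^ p / fact p) = (\<Sum>p\<in>{..<Suc N} - {0}. x ^ p / fact p)"
    by (rule sum.cong) auto
  also have "\<dots> = (\<Sum>p<Suc N. x ^ p / fact p) - 1"
    by (subst sum_diff) auto
  also have "(\<Sum>p<Suc N. x ^ p / fact p) \<le> exp x"
  proof -
    have "(\<Sum>p<Suc N. x ^ p /\<^sub>R fact p) \<le> exp x"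
      unfolding exp_def using 0 by (intro sum_le_suminf summable_exp_generic) auto
    then show ?thesis by (simp add: field_simps)
  qed
  finally show ?case by (simp add: bell_k_0)
next
  case (Suc k)
  have "(\<Sum>p=1..N. real (bell_k (Suc k) p) * x ^ p / fact p)
      = (\<Sum>p=1..N. \<Sum>j=1..N. real (bell_k k j) * (real (Stirling p j) * x ^ p / fact p))"
  proof (rule sum.cong[OF refl])
    fix p assume p: "p \<in> {1..N}"
    then have "Stirling p 0 = 0" by (cases p) auto
    have "real (bell_k (Suc k) p) = (\<Sum>j\<le>p. real (Stirling p j) * real (bell_k k j))"
      by (simp add: bell_k_Suc)
    \<comment> \<open>The term \<open>j = 0\<close> vanishes because \<open>p > 0\<close>, and those
      with \<open>j > p\<close> vanish too; a range independent of \<open>p\<close> lets the two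
      sums be swapped.\<close>
    also have "\<dots> = (\<Sum>j=1..N. real (Stirling p j) * real (bell_k k j))"
      using p \<open>Stirling p 0 = 0\<close> by (intro sum.mono_neutral_cong) (auto simp: not_le)
    finally show "real (bell_k (Suc k) p) * x ^ p / fact p
        = (\<Sum>j=1..N. real (bell_k k j) * (real (Stirling p j) * x ^ p / fact p))"
      by (simp only: sum_distrib_right sum_divide_distrib) (simp add: mult_ac)
  qed
  also have "\<dots> = (\<Sum>j=1..N. real (bell_k k j) * (\<Sum>p=1..N. real (Stirling p j) * x ^ p / fact p))"
    by (subst sum.swap) (simp add: sum_distrib_left)
  also have "\<dots> \<le> (\<Sum>j=1..N. real (bell_k k j) * ((exp x - 1) ^ j / fact j))"
  proof (intro sum_mono mult_left_mono)
    fix j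
    have "(\<Sum>p=1..N. real (Stirling p j) * x ^ p / fact p) \<le> (\<Sum>p\<le>N. real (Stirling p j) * x ^ p / fact p)"
      using Suc.prems by (intro sum_mono2) auto
    also have "\<dots> \<le> (exp x - 1) ^ j / fact j" using sum_Stirling_le Suc.prems by simp
    finally show "(\<Sum>p=1..N. real (Stirling p j) * x ^ p / fact p) \<le> (exp x - 1) ^ j / fact j" .
  qed simp
  also have "\<dots> = (\<Sum>j=1..N. real (bell_k k j) * (exp x - 1) ^ j / fact j)" by simp
  also have "\<dots> \<le> ((\<lambda>x. exp x - 1) ^^ Suc k) (exp x - 1)"
    using Suc.IH Suc.prems by simp
  finally show ?case by (simp only: funpow_Suc_right[of "Suc k"] o_apply)
qed

text \<open>All terms of the generating function are nonnegative, so each one is at most the whole.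
  The free parameter \<open>x\<close> is to be chosen well in each regime.\<close>

lemma bell_k_le:
  fixes x :: real
  assumes "x > 0" "p \<ge> 1"
  shows "real (bell_k k p) \<le> fact p * ((\<lambda>x. exp x - 1) ^^ Suc k) x / x ^ p"
proof -
  have "real (bell_k k p) * x ^ p / fact p \<le> (\<Sum>q=1..p. real (bell_k k q) * x ^ q / fact q)"
    using assms by (intro member_le_sum) auto
  also have "\<dots> \<le> ((\<lambda>x. exp x - 1) ^^ Suc k) x" using assms by (intro sum_bell_k_le) simp
  finally show ?thesis using assms by (simp add: field_simps)
qed

section \<open>Bounds on the iterates of e^x - 1\<close>

lemma funpow_expm1_nonneg:
  fixes x :: real
  shows "x \<ge> 0 \<Longrightarrow> ((\<lambda>x. exp x - 1) ^^ n) x \<ge> 0"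
  by (induction n) auto

lemma mono_funpow_exp: "x \<le> y \<Longrightarrow> (exp ^^ n) x \<le> (exp ^^ n) (y::real)"
  by (induction n) auto

lemma funpow_expm1_le_exp:
  fixes x :: real
  shows "((\<lambda>x. exp x - 1) ^^ n) x \<le> (exp ^^ n) x"
proof (induction n)
  case (Suc n)
  then have "exp (((\<lambda>x. exp x - 1) ^^ n) x) \<le> exp ((exp ^^ n) x)" by simp
  then show ?case unfolding funpow.simps o_apply by linarith
qed simp

text \<open>On [0,1) one has e^y - 1 \<le> y/(1 - y), and the n-th iterate of the Moebius map y/(1 -
  y) is y/(1 - n y).\<close>

lemma funpow_expm1_le_moebius:
  fixes x :: real
  assumes "x \<ge> 0" "real n * x < 1"
  shows "((\<lambda>x. exp x - 1) ^^ n) x \<le> x / (1 - real n * x)"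
  using assms(2)
proof (induction n)
  case (Suc n)
  define y where "y = x / (1 - real n * x)"
  have nx: "real n * x < 1" "0 < 1 - real n * x - x"
    using Suc.prems assms(1) by (auto simp: algebra_simps)
  then have y: "0 \<le> y" "y < 1" using assms(1) by (auto simp: y_def field_simps)
  have "exp (((\<lambda>x. exp x - 1) ^^ n) x) \<le> exp y" using Suc.IH nx by (simp add: y_def)
  also have "exp y \<le> 1 / (1 - y)"
  proof -
    have "1 - y \<le> exp (- y)" using exp_ge_add_one_self[of "-y"] by simp
    then show ?thesis using y by (simp add: exp_minus field_simps)
  qed
  finally have "((\<lambda>x. exp x - 1) ^^ Suc n) x \<le> 1 / (1 - y) - 1" by simp
  also have "\<dots> = y / (1 - y)" using y by (simp add: field_simps)
  also have "\<dots> = x / (1 - real n * x - x)" using nx y by (simp add: y_def divide_simps)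
  finally show ?case by (simp add: algebra_simps)
qed simp

section \<open>Upper bounds from three choices of x\<close>

lemma bell_k_le_funpow_exp:
  fixes x :: real
  assumes "x > 0" "p \<ge> 1" "(exp ^^ k) x \<le> real p"
  shows "real (bell_k k p) \<le> (exp 1 * real p / x) ^ p"
proof -
  have "((\<lambda>x. exp x - 1) ^^ Suc k) x \<le> (exp ^^ Suc k) x" by (rule funpow_expm1_le_exp)
  also have "\<dots> \<le> exp (real p)" using assms(3) by simp
  also have "\<dots> = exp 1 ^ p" by (simp flip: exp_of_nat_mult)
  finally have "fact p * ((\<lambda>x. exp x - 1) ^^ Suc k) x / x ^ p \<le> real p ^ p * exp 1 ^ p / x ^ p"
    using assms(1) funpow_expm1_nonneg[of x "Suc k"] 
    by (intro divide_right_mono mult_mono fact_le_power[where 'a = real, simplified]) auto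
  then show ?thesis using bell_k_le[OF assms(1,2), of k]
    by (simp add: power_mult_distrib power_divide mult_ac)
qed

lemma bell_k_le_extra_levels:
  assumes "p \<ge> 1" "m \<ge> 1" "(exp ^^ d) 1 \<le> real p"
  shows "real (bell_k (d + m) p) \<le> (2 * exp 1 * real p * real m) ^ p"
proof -
  \<comment> \<open>With this \<open>x\<close> the Moebius bound after \<open>m\<close> iterations
    is exactly 1; the remaining \<open>d + 1\<close> iterations are compared with those of
    \<open>exp\<close>.\<close>
  define x where "x = 1 / real (m + 1)"
  have x: "x > 0" by (simp add: x_def)
  have "((\<lambda>x. exp x - 1) ^^ m) x \<le> x / (1 - real m * x)"
    using x by (intro funpow_expm1_le_moebius) (auto simp: x_def)
  also have "\<dots> = 1" by (simp add: x_def field_simps)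
  finally have 1: "((\<lambda>x. exp x - 1) ^^ m) x \<le> 1" .
  have "((\<lambda>x. exp x - 1) ^^ Suc (d + m)) x = ((\<lambda>x. exp x - 1) ^^ Suc d) (((\<lambda>x. exp x - 1) ^^ m) x)"
    by (metis add_Suc comp_apply funpow_add)
  also have "\<dots> \<le> (exp ^^ Suc d) (((\<lambda>x. exp x - 1) ^^ m) x)" by (rule funpow_expm1_le_exp)
  also have "\<dots> \<le> (exp ^^ Suc d) 1" using 1 by (rule mono_funpow_exp)
  also have "\<dots> \<le> exp (real p)" using assms(3) by simp
  also have "\<dots> = exp 1 ^ p" by (simp flip: exp_of_nat_mult)
  finally have "fact p * ((\<lambda>x. exp x - 1) ^^ Suc (d + m)) x / x ^ p \<le> real p ^ p * exp 1 ^ p / x ^ p"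
    using x funpow_expm1_nonneg[of x "Suc (d + m)"]
    by (intro divide_right_mono mult_mono fact_le_power[where 'a = real, simplified]) auto
  then have "real (bell_k (d + m) p) \<le> real p ^ p * exp 1 ^ p / x ^ p"
    using bell_k_le[OF x assms(1), of "d + m"] by linarith
  also have "\<dots> = (exp 1 * real p * real (m + 1)) ^ p"
    by (simp add: x_def power_mult_distrib power_divide mult_ac)
  also have "\<dots> \<le> (2 * exp 1 * real p * real m) ^ p"
  proof (rule power_mono)
    have "exp 1 * real p * real (m + 1) \<le> exp 1 * real p * (2 * real m)"
      using assms(2) by (intro mult_left_mono) auto
    then show "exp 1 * real p * real (m + 1) \<le> 2 * exp 1 * real p * real m" by (simp add: mult_ac)
  qed simp
  finally show ?thesis .
qed

text \<open>Here \<open>x\<close> is so small that all \<open>k + 1\<close> iterations together at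
  most double it. The value \<open>2 * x\<close> cancels one of the \<open>p\<close> factors of
  \<open>1 / x\<close>, which explains the exponent \<open>p - 1\<close>; this precision matters
  when the number of levels is exponential in \<open>p\<close>.\<close>

lemma bell_k_le_power_levels:
  assumes "p \<ge> 1"
  shows "real (bell_k k p) \<le> 2 * real p ^ p * (2 * real (k + 1)) ^ (p - 1)"
proof -
  define x where "x = 1 / (2 * real (k + 1))"
  have x: "x > 0" by (simp add: x_def)
  have "((\<lambda>x. exp x - 1) ^^ Suc k) x \<le> x / (1 - real (Suc k) * x)"
    using x by (intro funpow_expm1_le_moebius) (auto simp: x_def)
  also have "\<dots> = 2 * x" by (simp add: x_def field_simps)
  finally have "fact p * ((\<lambda>x. exp x - 1) ^^ Suc k) x / x ^ p \<le> real p ^ p * (2 * x) / x ^ p"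
    using x funpow_expm1_nonneg[of x "Suc k"]
    by (intro divide_right_mono mult_mono fact_le_power[where 'a = real, simplified]) auto
  then have "real (bell_k k p) \<le> real p ^ p * (2 * x) / x ^ p"
    using bell_k_le[OF x assms(1), of k] by linarith
  also have "x ^ p = x * x ^ (p - 1)" using assms by (cases p) auto
  also have "real p ^ p * (2 * x) / (x * x ^ (p - 1)) = 2 * real p ^ p * (1 / x) ^ (p - 1)"
    using x by (simp add: field_simps)
  also have "1 / x = 2 * real (k + 1)" by (simp add: x_def)
  finally show ?thesis .
qed

section \<open>Lower bounds\<close>

text \<open>S(i+j, j) is the complete homogeneous symmetric polynomial of degree i in 1,...,j.
  Keeping only the variables t,...,j leaves C(j-t+i, i) monomials, each at least t^i. The induction
  matches the Stirling recurrence with Pascal's rule.\<close>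

lemma Stirling_ge:
  assumes "1 \<le> t" "t \<le> j"
  shows "t ^ i * ((j - t + i) choose i) \<le> Stirling (i + j) j"
  using assms(2)
proof (induction "i + (j - t)" arbitrary: i j rule: less_induct)
  case less
  show ?case
  proof (cases i)
    case 0
    then show ?thesis by simp
  next
    case (Suc i')
    obtain j' where j: "j = Suc j'" using less.prems assms(1) by (cases j) auto
    have rec: "Stirling (i + j) j = j * Stirling (i' + j) j + Stirling (i + j') j'"
      by (simp add: Suc j)
    have a: "t * (t ^ i' * ((j - t + i') choose i')) \<le> j * Stirling (i' + j) j"
      using less.hyps[of i' j] less.prems Suc by (intro mult_mono) auto
    show ?thesis
    proof (cases "j = t")
      case True
      then have "t ^ i * ((j - t + i) choose i) = t * (t ^ i' * ((j - t + i') choose i'))"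
        using Suc by simp
      then show ?thesis using a rec by linarith
    next
      case False
      then have "t \<le> j'" using less.prems j by simp
      then have b: "t ^ i * ((j' - t + i) choose i) \<le> Stirling (i + j') j'"
        using less.hyps[of i j'] j by simp
      have "j - t + i = Suc (j' - t + i)" "j' - t + i = j - t + i'" using \<open>t \<le> j'\<close> j Suc by auto
      then have "(j - t + i) choose i = ((j - t + i') choose i') + ((j' - t + i) choose i)"
        using Suc by simp
      then have "t ^ i * ((j - t + i) choose i)
          = t * (t ^ i' * ((j - t + i') choose i')) + t ^ i * ((j' - t + i) choose i)"
        by (simp add: Suc algebra_simps)
      then show ?thesis using a b rec by linarith
    qed
  qed
qed

lemma Stirling_ge_power:
  assumes "1 \<le> j" "j \<le> n"
  shows "j ^ (n - j) \<le> Stirling n j"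
  using Stirling_ge[of j j "n - j"] assms by simp

lemma Stirling_ge_near_diagonal:
  assumes "1 \<le> i" "2 * i \<le> n"
  shows "(real n ^ 2 / (8 * real i)) ^ i \<le> real (Stirling n (n - i))"
proof -
  \<comment> \<open>This is n/4 rounded up: large enough for the factor \<open>t ^ i\<close>, yet
    leaving \<open>a = n - t\<close> at least n/2 for the binomial coefficient.\<close>
  define t where "t = (n + 3) div 4"
  have t: "1 \<le> t" "t \<le> n - i" "real n / 4 \<le> real t" "2 * t \<le> n"
    using assms by (auto simp: t_def)
  define a where "a = n - i - t + i"
  have a: "real a \<ge> real n / 2" "i \<le> a" using t assms by (auto simp: a_def)
  have "(real n ^ 2 / (8 * real i)) ^ i = (real n / 4) ^ i * (real n / 2 / real i) ^ i"
    by (simp add: power_mult_distrib[symmetric] power2_eq_square)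
  also have "\<dots> \<le> real t ^ i * (real a / real i) ^ i"
    using t a by (intro mult_mono power_mono divide_right_mono) auto
  also have "\<dots> \<le> real t ^ i * real (a choose i)"
    using binomial_ge_n_over_k_pow_k[OF a(2), where 'a = real] by (intro mult_left_mono) auto
  also have "\<dots> = real (t ^ i * (a choose i))" by simp
  also have "\<dots> \<le> real (Stirling (i + (n - i)) (n - i))"
    unfolding of_nat_le_iff a_def using Stirling_ge[OF t(1,2), of i] .
  finally show ?thesis using assms by simp
qed

lemma Stirling_pred: "Stirling (Suc n) n = Suc n choose 2"
proof (induction n)
  case (Suc n)
  have "Stirling (Suc (Suc n)) (Suc n) = Suc n + Stirling (Suc n) n" by simp
  also have "\<dots> = Suc n + (Suc n choose 2)" using Suc by simp
  also have "\<dots> = Suc (Suc n) choose 2" by (simp add: numeral_2_eq_2)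
  finally show ?case .
qed simp

section \<open>Lower bounds for the order-k Bell numbers\<close>

lemma bell_k_Suc_ge:
  assumes "j \<le> p"
  shows "Stirling p j * bell_k k j \<le> bell_k (Suc k) p"
  unfolding bell_k_Suc using assms by (intro member_le_sum) auto

lemma bell_k_mono: "k \<le> l \<Longrightarrow> bell_k k p \<le> bell_k l p"
proof (rule lift_Suc_mono_le[of "\<lambda>k. bell_k k p"])
  show "bell_k n p \<le> bell_k (Suc n) p" for n using bell_k_Suc_ge[of p p n] by simp
qed

lemma bell_k_pos: "bell_k k p \<ge> 1"
proof (induction k)
  case (Suc k)
  then show ?case using bell_k_Suc_ge[of p p k] by simp
qed (simp add: bell_k_0)

text \<open>The constant reproduces itself: 36 = 2 * 6 * 3, where 2 pays for rounding p/L down, 6^p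
  for the 36^j of the induction hypothesis (as 2j \<le> p, which is why L \<ge> 2 is required), and
  3^p for exp(L)^j \<le> e^p. \<open>L\<close> must stay general since the induction passes to
  \<open>exp L\<close>.\<close>

lemma bell_k_ge:
  fixes L :: real
  assumes "L \<ge> 2" "real p \<le> (exp ^^ k) L" "p \<ge> 1"
  shows "(real p / (36 * L)) ^ p \<le> real (bell_k k p)"
  using assms
proof (induction k arbitrary: p L)
  case 0
  then have "(real p / (36 * L)) ^ p \<le> 1" by (intro power_le_one) auto
  then show ?case by (simp add: bell_k_0)
next
  case (Suc k)
  show ?case
  proof (cases "real p < L")
    case True
    then have "(real p / (36 * L)) ^ p \<le> 1" using Suc.prems by (intro power_le_one) auto
    then show ?thesis using bell_k_pos[of "Suc k" p] by linarith
  next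
    case False
    define j where "j = nat \<lfloor>real p / L\<rfloor>"
    have pL: "real p / L \<ge> 1" using False Suc.prems by (simp add: field_simps)
    then have j1: "j \<ge> 1" unfolding j_def by (simp add: le_nat_iff)
    have jr: "real j = of_int \<lfloor>real p / L\<rfloor>" unfolding j_def using pL by simp
    have j_le: "real j \<le> real p / L" unfolding jr by simp
    have j_ge: "real p / (2 * L) \<le> real j"
    proof -
      have "real p / L < real j + 1" unfolding jr by linarith
      moreover have "real j + 1 \<le> 2 * real j" using j1 by simp
      ultimately show ?thesis by (simp add: field_simps)
    qed
    have Lj: "L * real j \<le> real p" using j_le Suc.prems(1) by (simp add: field_simps)
    have "2 * real j \<le> L * real j" using Suc.prems(1) by (intro mult_right_mono) auto
    then have j2: "2 * j \<le> p" using Lj by linarith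
    have IH: "(real j / (36 * exp L)) ^ j \<le> real (bell_k k j)"
    proof (rule Suc.IH[OF _ _ j1])
      show "2 \<le> exp L" using exp_ge_add_one_self[of L] Suc.prems(1) by linarith
      show "real j \<le> (exp ^^ k) (exp L)" using Suc.prems(2) j2 by (simp add: funpow_swap1)
    qed
    have "exp L ^ j = exp (L * real j)" by (simp add: exp_of_nat2_mult)
    also have "\<dots> \<le> exp (real p)" using Lj by simp
    also have "\<dots> = exp 1 ^ p" by (simp flip: exp_of_nat_mult)
    also have "\<dots> \<le> 3 ^ p" by (intro power_mono exp_le) simp
    finally have e: "exp L ^ j \<le> 3 ^ p" .
    have "(36::real) ^ j = 6 ^ (2 * j)" by (simp add: power_mult)
    also have "\<dots> \<le> 6 ^ p" using j2 by (intro power_increasing) auto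
    finally have s: "(36::real) ^ j \<le> 6 ^ p" .
    have "(real p / (36 * L)) ^ p = (real p / (2 * L)) ^ p / (6 ^ p * 3 ^ p)"
      by (simp add: power_mult_distrib[symmetric] power_divide[symmetric] mult_ac)
    also have "\<dots> \<le> real j ^ p / (36 ^ j * exp L ^ j)"
      using e s j_ge Suc.prems(1) by (intro frac_le power_mono mult_mono mult_pos_pos) auto
    also have "real j ^ p = real j ^ (p - j) * real j ^ j" using j2 by (simp flip: power_add)
    also have "real j ^ (p - j) * real j ^ j / (36 ^ j * exp L ^ j) = real (j ^ (p - j)) * (real j / (36 * exp L)) ^ j"
      by (simp add: power_mult_distrib power_divide)
    also have "\<dots> \<le> real (Stirling p j) * real (bell_k k j)"
      using IH Stirling_ge_power[OF j1, of p] j2 Suc.prems(1) by (intro mult_mono) (auto simp flip: of_nat_power)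
    also have "\<dots> \<le> real (bell_k (Suc k) p)"
      using bell_k_Suc_ge[of j p k] j2 by (simp flip: of_nat_mult)
    finally show ?thesis .
  qed
qed

text \<open>Each extra level removes a fraction \<open>1/n\<close> of the elements.\<close>

lemma bell_k_ge_extra_levels:
  fixes c :: real
  assumes base: "\<And>q. 1 \<le> q \<Longrightarrow> q \<le> N \<Longrightarrow> (c * real q) ^ q \<le> real (bell_k d q)"
    and c: "0 < c" "c \<le> 1 / 52488"
    and "n \<ge> 1" "n \<le> p" "p \<le> N"
  shows "(c * real p * real n) ^ p \<le> real (bell_k (d + (n - 1)) p)"
  using assms(4-6)
proof (induction n arbitrary: p rule: nat_induct_at_least)
  case base
  then show ?case using assms(1) by simp
next
  case (Suc m p)
  define n where "n = Suc m"
  \<comment> \<open>The top level merges \<open>p\<close> blocks into \<open>j = p - i\<close>,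
    roughly p (1 - 1/n), leaving \<open>m = n - 1\<close> for the induction hypothesis.\<close>
  define i where "i = p div n"
  define j where "j = p - i"
  have n: "n \<ge> 2" "n \<le> p" using Suc by (auto simp: n_def)
  have i1: "i \<ge> 1" unfolding i_def using n by (simp add: Suc_le_eq div_greater_zero_iff)
  have ni: "n * i \<le> p" unfolding i_def by simp
  have "2 * i \<le> n * i" using n by simp
  then have i2: "2 * i \<le> p" using ni by linarith
  have "p < n * (i + 1)" unfolding i_def using n by (metis add.commute dividend_less_times_div less_le_trans mult_Suc_right plus_1_eq_Suc pos2)
  also have "\<dots> \<le> n * (2 * i)" using i1 by (intro mult_le_mono) auto
  finally have p_le: "real p \<le> 2 * real n * real i"
    by (metis (mono_tags, lifting) less_imp_le mult.assoc mult.commute of_nat_le_iff of_nat_mult of_nat_numeral)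
  have jn: "real j * real n \<ge> real p * real m"
  proof -
    have "real j = real p - real i" using i2 by (simp add: j_def)
    moreover have "real n * real i \<le> real p" using ni by (simp flip: of_nat_mult)
    moreover have "real j * real n = (real p - real i) * real n" using \<open>real j = _\<close> by simp
    ultimately show ?thesis by (simp add: n_def algebra_simps)
  qed
  have mj: "m \<le> j"
  proof -
    have "real m * real n \<le> real p * real m" using n by (simp add: mult.commute mult_left_mono)
    then have "real m * real n \<le> real j * real n" using jn by linarith
    then show ?thesis using n by simp
  qed
  have j: "j \<le> p" "p = i + j" using i2 by (auto simp: j_def)
  have m1: "m \<ge> 1" using Suc by simp
  have IH: "(c * real j * real m) ^ j \<le> real (bell_k (d + (m - 1)) j)"
    using Suc mj j by auto
  have S: "(real p * real n / 8) ^ i \<le> real (Stirling p j)"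
  proof -
    have "real n * real i \<le> real p" using ni by (simp flip: of_nat_mult)
    then have "real p * real n / 8 \<le> real p ^ 2 / (8 * real i)"
      using i1 mult_left_mono[of "real n * real i" "real p" "real p"]
      by (simp add: field_simps power2_eq_square)
    then have "(real p * real n / 8) ^ i \<le> (real p ^ 2 / (8 * real i)) ^ i" by (intro power_mono) auto
    then show ?thesis using Stirling_ge_near_diagonal[OF i1 i2] by (simp add: j_def)
  qed
  \<comment> \<open>\<open>r\<close> measures the loss in passing from \<open>n\<close> to
    \<open>m\<close>. Since 1/r \<le> e^(1/m) and p \<le> 4 m i, one gets (1/r)^(2p) \<le> e^(8i)
    \<le> 6561^i with 6561 = 3^8.\<close>
  define r where "r = real m / real n"
  have r: "0 < r" "r \<le> 1" using m1 by (auto simp: r_def n_def)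
  have "1 / r = 1 + 1 / real m" using m1 by (simp add: r_def n_def field_simps)
  also have "\<dots> \<le> exp (1 / real m)" by (rule exp_ge_add_one_self)
  finally have "(1 / r) ^ (2 * p) \<le> exp (1 / real m) ^ (2 * p)" using r by (intro power_mono) auto
  also have "\<dots> = exp (real (2 * p) * (1 / real m))" by (rule exp_of_nat_mult[symmetric])
  also have "\<dots> \<le> exp (real (8 * i) * 1)"
  proof -
    have "real p \<le> 4 * real m * real i"
    proof -
      have "2 * real n * real i \<le> 4 * real m * real i" using m1 by (intro mult_right_mono) (auto simp: n_def)
      then show ?thesis using p_le by linarith
    qed
    then show ?thesis using m1 by (simp add: field_simps)
  qed
  also have "\<dots> = exp 1 ^ (8 * i)" by (rule exp_of_nat_mult)
  also have "\<dots> \<le> 3 ^ (8 * i)" by (intro power_mono exp_le) simp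
  also have "\<dots> = 6561 ^ i" by (simp add: power_mult)
  finally have "(1 / 6561) ^ i \<le> r ^ (2 * p)" using r by (simp add: power_divide field_simps)
  also have "\<dots> \<le> r ^ (2 * j)" using r j by (intro power_decreasing) auto
  finally have r6561: "(1 / 6561) ^ i \<le> (r ^ 2) ^ j" by (simp add: power_mult)
  have "(c * real p * real n) ^ p = c ^ i * c ^ j * (real p * real n) ^ i * (real p * real n) ^ j"
    unfolding mult.assoc power_mult_distrib[of c] by (simp add: j(2) power_add mult_ac)
  also have "\<dots> \<le> ((1 / 6561) ^ i * (1 / 8) ^ i) * c ^ j * (real p * real n) ^ i * (real p * real n) ^ j"
    using c by (intro mult_right_mono) (auto simp: power_mult_distrib[symmetric] intro!: power_mono)
  also have "\<dots> \<le> ((r ^ 2) ^ j * (1 / 8) ^ i) * c ^ j * (real p * real n) ^ i * (real p * real n) ^ j"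
    using r6561 c by (intro mult_right_mono) auto
  also have "\<dots> = (real p * real n / 8) ^ i * (c * (r ^ 2 * (real p * real n))) ^ j"
    by (simp add: power_mult_distrib power_divide mult_ac)
  also have "\<dots> \<le> (real p * real n / 8) ^ i * (c * real j * real m) ^ j"
  proof -
    have "r ^ 2 * (real p * real n) = real p * real m * r"
      using n by (simp add: r_def power2_eq_square)
    also have "\<dots> \<le> real j * real n * r" using jn r by (intro mult_right_mono) auto
    also have "\<dots> = real j * real m" using n by (simp add: r_def)
    finally have "c * (r ^ 2 * (real p * real n)) \<le> c * real j * real m"
      using c by (simp add: mult.assoc mult_left_mono)
    then show ?thesis using c by (intro mult_left_mono power_mono) auto
  qed
  also have "\<dots> \<le> real (Stirling p j) * real (bell_k (d + (m - 1)) j)"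
    using S IH c by (intro mult_mono) auto
  also have "\<dots> \<le> real (bell_k (Suc (d + (m - 1))) p)"
    using bell_k_Suc_ge[OF j(1), of "d + (m - 1)"] by (simp flip: of_nat_mult)
  also have "Suc (d + (m - 1)) = d + (n - 1)" using m1 by (simp add: n_def)
  finally show ?case by (simp add: n_def)
qed

text \<open>Divided by \<open>2\<^sup>p\<^sup>-\<^sup>1\<close>, the left-hand side counts the maximal chains in the partition lattice with
  their \<open>p - 1\<close> steps placed at distinct levels.\<close>

lemma bell_k_ge_maximal_chains:
  "fact p * fact (p - 1) * (k choose (p - 1)) \<le> 2 ^ (p - 1) * bell_k k p"
proof (induction k arbitrary: p)
  case 0
  show ?case
  proof (cases "p \<le> 1")
    case True
    then show ?thesis by (auto simp: bell_k_0 le_Suc_eq)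
  qed (simp add: binomial_eq_0)
next
  case (Suc k)
  show ?case
  \<comment> \<open>For \<open>p = 0\<close> and \<open>p = 1\<close> the truncated
    \<open>p - 1\<close> is 0, and the claim is positivity of \<open>bell_k\<close>.\<close>
  proof (cases "p \<le> 1")
    case True
    then show ?thesis using bell_k_pos[of "Suc k" p] by (auto simp: le_Suc_eq)
  next
    case False
    then obtain n where p: "p = Suc (Suc n)" by (metis One_nat_def Suc_le_D not_less_eq_eq not_le less_imp_le numeral_2_eq_2 Suc_leI)
    have two: "2 * (p choose 2) = p * Suc n" using p by (simp add: choose_two)
    \<comment> \<open>Only two terms are kept: \<open>j = p\<close>, a level where nothing changes,
      and \<open>j = p - 1\<close>, a level merging one of C(p,2) pairs. They correspond to the two
      terms of Pascal's rule.\<close>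
    have "bell_k (Suc k) p \<ge> (\<Sum>j\<in>{p, Suc n}. Stirling p j * bell_k k j)"
      unfolding bell_k_Suc by (intro sum_mono2) (auto simp: p)
    then have rec: "bell_k k p + (p choose 2) * bell_k k (Suc n) \<le> bell_k (Suc k) p"
      by (simp add: p Stirling_pred del: Stirling.simps)
    have "fact p * fact (Suc n) * (Suc k choose Suc n)
        = fact p * fact (Suc n) * (k choose Suc n) + (p * Suc n) * (fact (Suc n) * fact n * (k choose n))"
      unfolding binomial_Suc_Suc p fact_Suc[of "Suc n"] fact_Suc[of n] of_nat_id by (simp only: algebra_simps)
    also have "\<dots> \<le> 2 ^ Suc n * bell_k k p + (p * Suc n) * (2 ^ n * bell_k k (Suc n))"
      using Suc.IH[of p] Suc.IH[of "Suc n"] by (intro add_mono mult_left_mono) (auto simp: p)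
    also have "\<dots> = 2 ^ Suc n * (bell_k k p + (p choose 2) * bell_k k (Suc n))"
      unfolding two[symmetric] by (simp add: algebra_simps)
    also have "\<dots> \<le> 2 ^ Suc n * bell_k (Suc k) p" using rec by (intro mult_left_mono) auto
    finally show ?thesis by (simp add: p)
  qed
qed

text \<open>The single term n^n/n! of the series of e^n is at most e^n \<le> 3^n.\<close>

lemma fact_ge_power_div_3: "(real n / 3) ^ n \<le> fact n"
proof -
  have "(\<Sum>i\<in>{n}. real n ^ i /\<^sub>R fact i) \<le> exp (real n)"
    unfolding exp_def by (intro sum_le_suminf summable_exp_generic) auto
  also have "\<dots> = exp 1 ^ n" by (simp flip: exp_of_nat_mult)
  also have "\<dots> \<le> 3 ^ n" by (intro power_mono exp_le) simp
  finally show ?thesis by (simp add: power_divide field_simps)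
qed

lemma bell_k_ge_power_levels:
  assumes "p \<ge> 2" "p \<le> k"
  shows "(real p / 18) ^ p * real k ^ (p - 1) \<le> real (bell_k k p)"
proof -
  define n where "n = p - 1"
  have n: "n \<ge> 1" "n \<le> k" "p = Suc n" using assms by (auto simp: n_def)
  \<comment> \<open>18 = 3 * 6: the 3 is for \<open>fact p\<close>, and the 6 absorbs the 3 for
    \<open>fact n\<close> and the 2 coming from the chain count.\<close>
  have "(real p / 18) ^ p * real k ^ n * 2 ^ n \<le> (real p / 3) ^ p * (1 / 6) ^ n * real k ^ n * 2 ^ n"
  proof -
    have "(real p / 18) ^ p = (real p / 3) ^ p * (1 / 6) ^ p"
      by (simp flip: power_mult_distrib)
    also have "\<dots> \<le> (real p / 3) ^ p * (1 / 6) ^ n"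
      using n by (intro mult_left_mono power_decreasing) auto
    finally show ?thesis by (intro mult_right_mono) auto
  qed
  also have "\<dots> = (real p / 3) ^ p * ((real n / 3) ^ n * (real k / real n) ^ n)"
  proof -
    have "(1 / 6) ^ n * real k ^ n * 2 ^ n = (real n / 3) ^ n * (real k / real n) ^ n"
      unfolding power_mult_distrib[symmetric] using n by simp
    then show ?thesis by (simp only: mult.assoc)
  qed
  also have "\<dots> \<le> fact p * (fact n * real (k choose n))"
    using n binomial_ge_n_over_k_pow_k[OF n(2), where 'a = real]
    by (intro mult_mono fact_ge_power_div_3) auto
  also have "\<dots> = real (fact p * fact n * (k choose n))" by simp
  also have "\<dots> \<le> real (2 ^ n * bell_k k p)"
    unfolding of_nat_le_iff using bell_k_ge_maximal_chains[of p k] by (simp add: n)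
  finally show ?thesis by (simp add: n_def)
qed

section \<open>Iterated logarithms and the asymptotics\<close>

lemma iter_ln_0: "iter_ln 0 x = x"
  and iter_ln_Suc: "iter_ln (Suc n) x = ln (iter_ln n x)"
  by (simp_all add: iter_ln_def)

text \<open>Since ln y \<le> y - 1, every logarithm lowers the value by at least 1. This shows that
  \<open>log_star\<close> is attained and that \<open>k0\<close> is at most
  \<open>p\<close>.\<close>

lemma iter_ln_le_diff:
  assumes "\<And>i. i < n \<Longrightarrow> iter_ln i x > 0"
  shows "iter_ln n x \<le> x - real n"
  using assms
proof (induction n)
  case (Suc n)
  then have "ln (iter_ln n x) \<le> iter_ln n x - 1" by (intro ln_le_minus_one) auto
  then show ?case using Suc by (force simp: iter_ln_Suc)
qed (simp add: iter_ln_0)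

lemma funpow_exp_iter_ln:
  assumes "\<And>i. i < n \<Longrightarrow> iter_ln i x > 0"
  shows "(exp ^^ n) (iter_ln n x) = x"
  using assms
proof (induction n)
  case (Suc n)
  then show ?case by (simp add: iter_ln_Suc funpow_swap1)
qed (simp add: iter_ln_0)

lemma iter_ln_gt_1: "i < log_star x \<Longrightarrow> iter_ln i x > 1"
  unfolding log_star_def using not_less_Least by fastforce

text \<open>If all iterates exceeded 1, the one of index \<lceil>x\<rceil> would, by the linear
  decrease, be at most 0.\<close>

lemma iter_ln_log_star: "iter_ln (log_star x) x \<le> 1"
proof -
  have "\<exists>n. iter_ln n x \<le> 1"
  proof (rule ccontr)
    assume "\<nexists>n. iter_ln n x \<le> 1"
    then have gt: "iter_ln n x > 1" for n by (simp add: not_le)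
    have "iter_ln (nat \<lceil>x\<rceil>) x \<le> x - real (nat \<lceil>x\<rceil>)"
      using gt by (intro iter_ln_le_diff) (smt (verit))
    moreover have "x \<le> real (nat \<lceil>x\<rceil>)" by linarith
    ultimately show False using gt[of "nat \<lceil>x\<rceil>"] by linarith
  qed
  then show ?thesis unfolding log_star_def by (rule LeastI_ex)
qed

lemma le_root_powr:
  assumes "a \<ge> 0" "a ^ p \<le> b" "p \<ge> 1"
  shows "a \<le> b powr (1 / real p)"
proof -
  have "a = (a ^ p) powr (1 / real p)"
    using assms by (cases "a = 0") (auto simp: powr_powr simp flip: powr_realpow)
  also have "\<dots> \<le> b powr (1 / real p)" using assms by (intro powr_mono2) auto
  finally show ?thesis .
qed

lemma root_powr_le:
  assumes "a \<ge> 0" "b \<ge> 0" "b \<le> a ^ p" "p \<ge> 1"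
  shows "b powr (1 / real p) \<le> a"
proof -
  have "b powr (1 / real p) \<le> (a ^ p) powr (1 / real p)" using assms by (intro powr_mono2) auto
  also have "\<dots> = a"
    using assms by (cases "a = 0") (auto simp: powr_powr simp flip: powr_realpow)
  finally show ?thesis .
qed

theorem theorem4:
  "\<exists>c C :: real. c > 0 \<and> C > 0 \<and>
    (\<forall>p k :: nat. p \<ge> 2 \<longrightarrow> k \<ge> 1 \<longrightarrow>
      (let k0 = log_star (real p) - 1;
           b = real (bell_k k p) powr (1 / real p) in
        (k \<le> k0 \<longrightarrow>
           c * (real p / iter_ln k (real p)) \<le> b \<and> b \<le> C * (real p / iter_ln k (real p))) \<and>
        (k > k0 \<longrightarrow>
           c * (real p * real (k - k0) powr (1 - 1 / real p)) \<le> b \<and>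
           b \<le> C * (real p * real (k - k0) powr (1 - 1 / real p)) \<and>
           c * (real p * min (real k powr (1 - 1 / real p)) (real (k - k0))) \<le> b \<and>
           b \<le> C * (real p * min (real k powr (1 - 1 / real p)) (real (k - k0))))))"
proof (rule exI[of _ "1 / 104976"], rule exI[of _ 12], intro conjI allI impI)
  \<comment> \<open>12 = 2 * 3 * 2 comes from \<open>2 * exp 1\<close> and from m \<le> 2 M below;
    104976 = 2 * 52488 has an extra 2 because the two forms of the second estimate differ by at most
    that factor.\<close>
  fix p k :: nat
  assume p: "p \<ge> 2" and k: "k \<ge> 1"
  define k0 where "k0 = log_star (real p) - 1"
  define b where "b = real (bell_k k p) powr (1 / real p)"
  \<comment> \<open>As p > 1, the subtraction defining \<open>k0\<close> is not truncated.\<close>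
  have "log_star (real p) \<noteq> 0"
    using iter_ln_log_star[of "real p"] p by (intro notI) (simp add: iter_ln_0)
  then have ls: "log_star (real p) = Suc k0" by (simp add: k0_def)
  have gt1: "iter_ln i (real p) > 1" if "i \<le> k0" for i
    using that ls by (intro iter_ln_gt_1) simp
  have inv: "(exp ^^ i) (iter_ln i (real p)) = real p" if "i \<le> Suc k0" for i
  proof (rule funpow_exp_iter_ln)
    fix n assume "n < i"
    then show "iter_ln n (real p) > 0" using gt1[of n] that by simp
  qed
  \<comment> \<open>The two sides of the definition of \<open>k0\<close>: this bound allows L = e at
    level \<open>k0\<close> in the lower estimate, and \<open>p_ge\<close> is the hypothesis of the
    upper one.\<close>
  have p_le: "real p \<le> (exp ^^ k0) (exp 1)"
  proof -
    have "real p = (exp ^^ Suc k0) (iter_ln (Suc k0) (real p))" using inv[of "Suc k0"] by simp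
    also have "\<dots> \<le> (exp ^^ Suc k0) 1"
      using iter_ln_log_star[of "real p"] ls by (intro mono_funpow_exp) simp
    finally show ?thesis by (simp add: funpow_swap1)
  qed
  have p_ge: "(exp ^^ k0) 1 \<le> real p"
    using mono_funpow_exp[of 1 "iter_ln k0 (real p)" k0] gt1[of k0] inv[of k0] by simp
  have "k0 \<le> p"
  proof -
    have "iter_ln k0 (real p) \<le> real p - real k0"
    proof (rule iter_ln_le_diff)
      fix n assume "n < k0"
      then show "iter_ln n (real p) > 0" using gt1[of n] by simp
    qed
    then show ?thesis using gt1[of k0] by simp
  qed
  also have "p < 2 ^ p" by (rule less_exp)
  finally have k0_less: "k0 < 2 ^ p" .
  have small: "1 / 104976 * (real p / iter_ln k (real p)) \<le> b \<and> b \<le> 12 * (real p / iter_ln k (real p))"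
    if "k \<le> k0"
  proof
    define x where "x = iter_ln k (real p)"
    have x: "x > 1" "(exp ^^ k) x = real p" using gt1 inv that by (auto simp: x_def)
    \<comment> \<open>\<open>L = 2 * x\<close> instead of \<open>x\<close> ensures L \<ge> 2, as
      only x > 1 is known.\<close>
    have "(real p / (36 * (2 * x))) ^ p \<le> real (bell_k k p)"
      using x p mono_funpow_exp[of x "2 * x" k] by (intro bell_k_ge) auto
    then have "real p / (36 * (2 * x)) \<le> b"
      unfolding b_def using x p by (intro le_root_powr) auto
    moreover have "1 / 104976 * (real p / x) \<le> real p / (36 * (2 * x))"
      using x by (simp add: field_simps)
    ultimately show "1 / 104976 * (real p / iter_ln k (real p)) \<le> b" by (simp add: x_def)
    have "real (bell_k k p) \<le> (exp 1 * real p / x) ^ p"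
      using x p by (intro bell_k_le_funpow_exp) auto
    then have "b \<le> exp 1 * real p / x"
      unfolding b_def using x p by (intro root_powr_le) auto
    also have "\<dots> \<le> 12 * real p / x"
      using exp_le x by (intro divide_right_mono mult_right_mono) auto
    finally show "b \<le> 12 * (real p / iter_ln k (real p))" by (simp add: x_def)
  qed
  have large: "1 / 104976 * (real p * real (k - k0) powr (1 - 1 / real p)) \<le> b \<and>
      b \<le> 12 * (real p * real (k - k0) powr (1 - 1 / real p)) \<and>
      1 / 104976 * (real p * min (real k powr (1 - 1 / real p)) (real (k - k0))) \<le> b \<and>
      b \<le> 12 * (real p * min (real k powr (1 - 1 / real p)) (real (k - k0)))"
    if "k > k0"
  proof -
    define m where "m = k - k0"
    define M where "M = real m powr (1 - 1 / real p)"
    define W where "W = min (real k powr (1 - 1 / real p)) (real m)"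
    have m: "m \<ge> 1" "k = k0 + m" "m \<le> k" using that by (auto simp: m_def)
    have M0: "M > 0" using m by (simp add: M_def)
    have M_pow: "M ^ p = real m ^ (p - 1)"
    proof -
      have "M ^ p = real m powr ((1 - 1 / real p) * real p)"
        using m by (simp add: M_def powr_powr flip: powr_realpow)
      also have "(1 - 1 / real p) * real p = real (p - 1)" using p by (simp add: field_simps)
      finally show ?thesis using m by (simp add: powr_realpow)
    qed
    have M_le: "M \<le> real m"
      using powr_mono[of "1 - 1 / real p" 1 "real m"] m by (simp add: M_def)
    \<comment> \<open>m equals m^(1/p) M, and m^(1/p) \<le> 2 in this range, so the exponents 1 and
      1 - 1/p agree up to a factor 2. Beyond 2^p, \<open>k_le\<close> makes k and m comparable
      instead, because k0 < 2^p.\<close>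
    have m_le: "real m \<le> 2 * M" if "m \<le> 2 ^ p"
    proof -
      have "real m powr (1 / real p) \<le> 2"
        using that p by (intro root_powr_le) (auto simp flip: of_nat_le_iff)
      moreover have "real m = real m powr (1 / real p) * M"
        using m by (simp add: M_def flip: powr_add)
      ultimately show ?thesis using M0 by (metis less_imp_le mult_right_mono)
    qed
    have k_le: "Suc k \<le> 2 * m" if "\<not> m \<le> 2 ^ p" using that k0_less m by linarith
    have W_ge: "M \<le> W"
      using M_le m p by (auto simp: W_def M_def intro!: powr_mono2)
    have W_le: "W \<le> 2 * M"
    proof (cases "m \<le> 2 ^ p")
      case True
      then show ?thesis using m_le by (simp add: W_def)
    next
      case False
      have "real k powr (1 - 1 / real p) \<le> (2 * real m) powr (1 - 1 / real p)"
        using k_le[OF False] p by (intro powr_mono2) (auto simp: field_simps)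
      also have "\<dots> = 2 powr (1 - 1 / real p) * M" by (simp add: M_def powr_mult)
      also have "\<dots> \<le> 2 * M"
        using powr_mono[of "1 - 1 / real p" 1 2] M0 by (intro mult_right_mono) auto
      finally show ?thesis by (simp add: W_def)
    qed
    have lower: "1 / 52488 * (real p * M) \<le> b"
      unfolding b_def
    proof (rule le_root_powr)
      show "(1 / 52488 * (real p * M)) ^ p \<le> real (bell_k k p)"
      \<comment> \<open>For m \<le> p, the levels above \<open>k0\<close> are used one at a time,
        starting from L = e and 36 e \<le> 52488. For m > p, also k > p and maximal chains
        suffice.\<close>
      proof (cases "m \<le> p")
        case True
        have "(1 / 52488 * real p * real m) ^ p \<le> real (bell_k (k0 + (m - 1)) p)"
        proof (rule bell_k_ge_extra_levels[where N = p])
          fix q assume q: "1 \<le> q" "q \<le> p"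
          have "(1 / 52488 * real q) ^ q \<le> (real q / (36 * exp 1)) ^ q"
          proof (rule power_mono)
            have "real q / 52488 \<le> real q / (36 * exp 1)"
              using exp_le by (intro divide_left_mono) auto
            then show "1 / 52488 * real q \<le> real q / (36 * exp 1)" by simp
          qed simp
          also have "\<dots> \<le> real (bell_k k0 q)"
            using q p_le exp_ge_add_one_self[of 1] by (intro bell_k_ge) auto
          finally show "(1 / 52488 * real q) ^ q \<le> real (bell_k k0 q)" .
        qed (use m True in auto)
        also have "\<dots> \<le> real (bell_k k p)" using m by (simp add: bell_k_mono)
        finally have "(1 / 52488 * real p * real m) ^ p \<le> real (bell_k k p)" .
        moreover have "(1 / 52488 * (real p * M)) ^ p \<le> (1 / 52488 * real p * real m) ^ p"
          using M_le M0 by (intro power_mono) (auto simp: mult_left_mono)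
        ultimately show ?thesis by linarith
      next
        case False
        have "(1 / 52488 * (real p * M)) ^ p \<le> (real p / 18 * M) ^ p"
          using M0 by (intro power_mono) auto
        also have "\<dots> = (real p / 18) ^ p * real m ^ (p - 1)"
          by (simp only: power_mult_distrib M_pow)
        also have "\<dots> \<le> (real p / 18) ^ p * real k ^ (p - 1)"
          using m by (intro mult_left_mono power_mono) auto
        also have "\<dots> \<le> real (bell_k k p)" using False m p by (intro bell_k_ge_power_levels) auto
        finally show ?thesis .
      qed
    qed (use M0 p in auto)
    have upper: "b \<le> 12 * (real p * M)"
      unfolding b_def
    proof (rule root_powr_le)
      show "real (bell_k k p) \<le> (12 * (real p * M)) ^ p"
      \<comment> \<open>Up to 2^p levels, the bound linear in m loses only a factor 2 against M;
        beyond that, the bound with exponent \<open>p - 1\<close> is needed, with k + 1 \<le> 2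
        m.\<close>
      proof (cases "m \<le> 2 ^ p")
        case True
        have "real (bell_k k p) \<le> (2 * exp 1 * real p * real m) ^ p"
          unfolding m(2) using p m p_ge by (intro bell_k_le_extra_levels) auto
        also have "\<dots> \<le> (12 * (real p * M)) ^ p"
        proof (rule power_mono)
          have "2 * exp 1 * real p * real m \<le> 2 * 3 * real p * (2 * M)"
            using exp_le m_le[OF True] by (intro mult_mono) auto
          then show "2 * exp 1 * real p * real m \<le> 12 * (real p * M)" by simp
        qed simp
        finally show ?thesis .
      next
        case False
        have "real (bell_k k p) \<le> 2 * real p ^ p * (2 * real (k + 1)) ^ (p - 1)"
          using p by (intro bell_k_le_power_levels) auto
        also have "\<dots> \<le> 2 ^ p * real p ^ p * (4 * real m) ^ (p - 1)"
        proof (rule mult_mono[OF mult_right_mono power_mono])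
          show "2 * real (k + 1) \<le> 4 * real m" using of_nat_mono[OF k_le[OF False], where 'a = real] by simp
          show "(2::real) \<le> 2 ^ p" using self_le_power[of "2::real" p] p by simp
        qed auto
        also have "\<dots> = 2 ^ p * real p ^ p * (4 ^ (p - 1) * M ^ p)"
          by (simp add: M_pow power_mult_distrib)
        also have "\<dots> \<le> 2 ^ p * real p ^ p * (4 ^ p * M ^ p)"
          using M0 by (intro mult_left_mono mult_right_mono power_increasing) auto
        also have "\<dots> = (8 * (real p * M)) ^ p"
        proof -
          have "8 * (real p * M) = 2 * real p * (4 * M)" by simp
          then show ?thesis by (simp only: power_mult_distrib)
        qed
        also have "\<dots> \<le> (12 * (real p * M)) ^ p" using M0 by (intro power_mono) auto
        finally show ?thesis .
      qed
    qed (use M0 p in auto)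
    have "1 / 104976 * (real p * M) \<le> 1 / 52488 * (real p * M)" using M0 by simp
    moreover have "1 / 104976 * (real p * W) \<le> 1 / 52488 * (real p * M)"
      using mult_left_mono[OF W_le, of "real p"] by (simp add: algebra_simps)
    moreover have "12 * (real p * M) \<le> 12 * (real p * W)"
      using mult_left_mono[OF W_ge, of "real p"] by simp
    ultimately show ?thesis
      using lower upper unfolding M_def[symmetric] m_def[symmetric] W_def[symmetric] by linarith
  qed
  show "let k0 = log_star (real p) - 1; b = real (bell_k k p) powr (1 / real p) in
      (k \<le> k0 \<longrightarrow>
         1 / 104976 * (real p / iter_ln k (real p)) \<le> b \<and> b \<le> 12 * (real p / iter_ln k (real p))) \<and>
      (k > k0 \<longrightarrow>
         1 / 104976 * (real p * real (k - k0) powr (1 - 1 / real p)) \<le> b \<and>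
         b \<le> 12 * (real p * real (k - k0) powr (1 - 1 / real p)) \<and>
         1 / 104976 * (real p * min (real k powr (1 - 1 / real p)) (real (k - k0))) \<le> b \<and>
         b \<le> 12 * (real p * min (real k powr (1 - 1 / real p)) (real (k - k0))))"
    unfolding Let_def k0_def[symmetric] b_def[symmetric] using small large by blast
qed simp_all

end
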